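(* For every $n\ge4$, $$|\mathcal{RS}_n(123)|=6,$$ i.e. there are exactly $6$ simsun permutations of length $n$ that avoid the pattern $123$.
   Context: $\mathfrak{S}_n$ is the set of permutations of $\{1,\dots,n\}$, written in one-line notation $\pi=\pi_1\pi_2\dots\pi_n$. A permutation $\pi\in\mathfrak{S}_n$ is simsun if for every $3\le k\le n$, the subword of $\pi_1\pi_2\dots\pi_n$ consisting of the entries in $\{1,\dots,k\}$ (kept in their order) has no double descent, i.e. no three entries that are consecutive in that subword and in decreasing order. A permutation $\pi\in\mathfrak{S}_n$ avoids the pattern $\sigma\in\mathfrak{S}_k$ if there are no indices $i_1<i_2<\dots<i_k$ such that $\pi_{i_1}\pi_{i_2}\dots\pi_{i_k}$ is in the same relative order as $\sigma$. $\mathcal{RS}_n(\sigma)$ is the set of simsun permutations in $\mathfrak{S}_n$ avoiding $\sigma$. *)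

theory Defs
  imports "HOL-Combinatorics.Multiset_Permutations"
begin

text \<open>
  A permutation of \<open>{1..n}\<close> is the list of its entries in one-line notation, that is, an
  element of \<open>permutations_of_set {1..n}\<close>.  List positions are counted from \<open>0\<close>, entries
  from \<open>1\<close>.
\<close>

definition has_double_descent :: "nat list \<Rightarrow> bool" where
  "has_double_descent w \<longleftrightarrow>
     (\<exists>i. i + 2 < length w \<and> w ! i > w ! (i + 1) \<and> w ! (i + 1) > w ! (i + 2))"

definition simsun :: "nat list \<Rightarrow> bool" where
  "simsun p \<longleftrightarrow>
     (\<forall>k. 3 \<le> k \<and> k \<le> length p \<longrightarrow> \<not> has_double_descent (filter (\<lambda>x. x \<in> {1..k}) p))"

definition contains_pattern :: "nat list \<Rightarrow> nat list \<Rightarrow> bool" where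
  "contains_pattern p s \<longleftrightarrow>
     (\<exists>i :: nat \<Rightarrow> nat. strict_mono_on {..<length s} i \<and> i ` {..<length s} \<subseteq> {..<length p} \<and>
        (\<forall>a < length s. \<forall>b < length s. p ! i a < p ! i b \<longleftrightarrow> s ! a < s ! b))"

definition RS :: "nat \<Rightarrow> nat list \<Rightarrow> nat list set" where
  "RS n s = {p \<in> permutations_of_set {1..n}. simsun p \<and> \<not> contains_pattern p s}"

end

theory Submission
  imports Defs
begin

text \<open>
  A permutation of \<open>{1..n + 1}\<close> is \<open>u @ (n + 1) # v\<close> for a permutation \<open>q = u @ v\<close> of \<open>{1..n}\<close>.
  The simsun condition for bounds \<open>k \<le> n\<close> only sees \<open>q\<close>, and a maximal entry can only be the
  \<open>3\<close> of a \<open>123\<close>; so the insertion stays in the class if and only if \<open>q\<close> is in the class, \<open>u\<close>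
  has no ascent, and no double descent arises (\<open>RS_Suc_iff\<close>).

  Once \<open>q = x y z w \<dots>\<close> has at least four entries, exactly one insertion place survives
  (\<open>unique_insertion_place\<close>):

  \<^item> Before \<open>x\<close>, the new maximum makes a double descent precisely when \<open>x > y\<close>.

  \<^item> Between \<open>x\<close> and \<open>y\<close>, it makes one precisely when \<open>y > z\<close>.  Since \<open>q\<close> has neither a double
    descent nor a \<open>123\<close>, \<open>y > z\<close> is equivalent to \<open>x < y\<close>.

  \<^item> Between \<open>y\<close> and \<open>z\<close>, avoiding \<open>123\<close> forces \<open>x > y\<close>, hence \<open>y < z\<close>, and avoiding a double
    descent forces \<open>z < w\<close>; then \<open>y z w\<close> is a \<open>123\<close>.

  \<^item> Later, the three entries \<open>x\<close>, \<open>y\<close>, \<open>z\<close> before the maximum have no ascent, so they are a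
    double descent of \<open>q\<close>.

  So the number does not change when \<open>n \<ge> 4\<close> grows by one.  For \<open>n = 4\<close> the class is listed by
  carrying out the insertions from \<open>n = 2\<close>.  For \<open>n = 3\<close> the entry \<open>w\<close> is missing and the third case can survive, which is why the number
  still grows from \<open>n = 3\<close> to \<open>n = 4\<close>.
\<close>

section \<open>Recursive rules for double descents and for 123-avoidance\<close>

lemma has_double_descent_simps [simp]:
  "\<not> has_double_descent []"
  "\<not> has_double_descent [x]"
  "\<not> has_double_descent [x, y]"
  "has_double_descent (x # y # z # w) \<longleftrightarrow>
     (x > y \<and> y > z) \<or> has_double_descent (y # z # w)"
proof -
  have ex_nat_split: "(\<exists>i. P i) \<longleftrightarrow> P 0 \<or> (\<exists>i. P (Suc i))" for P :: "nat \<Rightarrow> bool"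
    by (metis not0_implies_Suc)
  show "has_double_descent (x # y # z # w) \<longleftrightarrow>
     (x > y \<and> y > z) \<or> has_double_descent (y # z # w)"
    unfolding has_double_descent_def by (subst ex_nat_split) simp
qed (auto simp: has_double_descent_def)

text \<open>
  Avoidance of \<open>123\<close> by recursion on the list: the tail may not contain an ascent above the first
  entry.  Expressing that with \<open>sorted_wrt\<close> makes the rules for appended lists available.
\<close>

fun avoids_123 :: "nat list \<Rightarrow> bool" where
  "avoids_123 [] \<longleftrightarrow> True"
| "avoids_123 (x # xs) \<longleftrightarrow> sorted_wrt (\<lambda>y z. \<not> (x < y \<and> y < z)) xs \<and> avoids_123 xs"

lemma avoids_123_iff_nth:
  "avoids_123 p \<longleftrightarrow> \<not> (\<exists>i j k. i < j \<and> j < k \<and> k < length p \<and> p ! i < p ! j \<and> p ! j < p ! k)"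
proof (induction p)
  case (Cons x p)
  let ?asc = "\<lambda>i j k. i < j \<and> j < k \<and> k < length (x # p) \<and>
    (x # p) ! i < (x # p) ! j \<and> (x # p) ! j < (x # p) ! k"
  \<comment> \<open>A \<open>123\<close> in \<open>x # p\<close> either starts at \<open>x\<close> or lies in \<open>p\<close>; \<open>j\<close> and \<open>k\<close> are never \<open>0\<close>.\<close>
  have "(\<exists>i j k. ?asc i j k) \<longleftrightarrow> (\<exists>j k. ?asc 0 (Suc j) (Suc k)) \<or>
      (\<exists>i j k. ?asc (Suc i) (Suc j) (Suc k))"
  proof
    assume "\<exists>i j k. ?asc i j k"
    then obtain i j k where asc: "?asc i j k"
      by blast
    then obtain j' k' where "j = Suc j'" "k = Suc k'"
      by (metis less_imp_Suc_add)
    with asc show "(\<exists>j k. ?asc 0 (Suc j) (Suc k)) \<or> (\<exists>i j k. ?asc (Suc i) (Suc j) (Suc k))"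
      by (cases i) blast+
  qed blast
  then show ?case
    using Cons.IH by (auto simp: sorted_wrt_iff_nth_less)
qed simp

lemma contains_pattern_123_iff: "contains_pattern p [1, 2, 3] \<longleftrightarrow> \<not> avoids_123 p"
proof
  assume "contains_pattern p [1, 2, 3]"
  then obtain i :: "nat \<Rightarrow> nat" where mono: "strict_mono_on {..<3} i"
    and range: "i ` {..<3} \<subseteq> {..<length p}"
    and order: "\<forall>a < 3. \<forall>b < 3. p ! i a < p ! i b \<longleftrightarrow> [1::nat, 2, 3] ! a < [1, 2, 3] ! b"
    by (auto simp: contains_pattern_def numeral_3_eq_3)
  have "i 0 < i 1" "i 1 < i 2" "i 2 < length p"
    using mono range by (auto simp: strict_mono_on_def image_subset_iff)
  moreover have "p ! i 0 < p ! i 1" "p ! i 1 < p ! i 2"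
    using order by simp_all
  ultimately show "\<not> avoids_123 p"
    unfolding avoids_123_iff_nth by blast
next
  assume "\<not> avoids_123 p"
  then obtain i j k where ijk: "i < j" "j < k" "k < length p" "p ! i < p ! j" "p ! j < p ! k"
    unfolding avoids_123_iff_nth by blast
  have "strict_mono_on {..<3} ((!) [i, j, k])" "(!) [i, j, k] ` {..<3} \<subseteq> {..<length p}"
    using ijk by (auto simp: strict_mono_on_def less_Suc_eq numeral_3_eq_3)
  moreover have "\<forall>a<3. \<forall>b<3. p ! ([i, j, k] ! a) < p ! ([i, j, k] ! b) \<longleftrightarrow>
      [1::nat, 2, 3] ! a < [1, 2, 3] ! b"
    using ijk by (auto simp: less_Suc_eq numeral_3_eq_3)
  ultimately show "contains_pattern p [1, 2, 3]"
    unfolding contains_pattern_def by (intro exI[of _ "(!) [i, j, k]"]) (simp add: numeral_3_eq_3)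
qed

lemma RS_123: "RS n [1, 2, 3] = {p \<in> permutations_of_set {1..n}. simsun p \<and> avoids_123 p}"
  by (simp only: RS_def contains_pattern_123_iff not_not)

lemma RS_123D:
  assumes "q \<in> RS n [1, 2, 3]"
  shows "set q = {1..n}" "distinct q" "length q = n" "simsun q" "avoids_123 q"
  using assms distinct_card[of q] unfolding RS_123 by (auto simp: permutations_of_set_def)

section \<open>Inserting a new maximum\<close>

text \<open>A new maximum can only play the role of the \<open>3\<close>, so it needs an ascent to its left.\<close>

lemma avoids_123_insert_max:
  assumes "\<forall>x \<in> set (u @ v). x < m"
  shows "avoids_123 (u @ m # v) \<longleftrightarrow> avoids_123 (u @ v) \<and> sorted_wrt (\<ge>) u"
  using assms
proof (induction u)
  case Nil
  then have "sorted_wrt (\<lambda>y z. \<not> (m < y \<and> y < z)) v"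
    by (induction v) auto
  then show ?case by simp
next
  case (Cons x u)
  then have "\<not> m \<le> y" if "y \<in> set u" for y
    using that by (auto simp: not_le)
  moreover have "z \<le> m" if "z \<in> set v" for z
    using Cons.prems that by (auto intro: less_imp_le)
  ultimately show ?case
    using Cons by (auto simp: sorted_wrt_append not_less)
qed

text \<open>
  The bound \<open>n + 1\<close> of the simsun condition constrains the whole permutation, the smaller bounds
  only what remains after deleting the maximum.
\<close>

lemma simsun_insert_max:
  assumes "set (u @ v) = {1..n}" "distinct (u @ v)" "2 \<le> n"
  shows "simsun (u @ Suc n # v) \<longleftrightarrow>
    simsun (u @ v) \<and> \<not> has_double_descent (u @ Suc n # v)"
proof -
  have len: "length (u @ v) = n"
    using assms distinct_card[of "u @ v"] by simp
  have "filter (\<lambda>x. x \<in> {1..k}) (u @ Suc n # v) = filter (\<lambda>x. x \<in> {1..k}) (u @ v)"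
    if "k \<le> n" for k
    using that by simp
  moreover have "filter (\<lambda>x. x \<in> {1..Suc n}) (u @ Suc n # v) = u @ Suc n # v"
    using assms(1) by (subst filter_True) auto
  moreover have "3 \<le> k \<and> k \<le> Suc n \<longleftrightarrow> 3 \<le> k \<and> k \<le> n \<or> k = Suc n" for k
    using \<open>2 \<le> n\<close> by auto
  ultimately show ?thesis
    unfolding simsun_def using len by (auto simp del: filter_append)
qed

lemma permutations_of_set_Suc_iff:
  "p \<in> permutations_of_set {1..Suc n} \<longleftrightarrow>
     (\<exists>u v. p = u @ Suc n # v \<and> u @ v \<in> permutations_of_set {1..n})"
proof
  assume p: "p \<in> permutations_of_set {1..Suc n}"
  then have "Suc n \<in> set p"
    by (simp add: permutations_of_set_def)
  then obtain u v where uv: "p = u @ Suc n # v"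
    by (auto dest: split_list)
  with p have "insert (Suc n) (set (u @ v)) = insert (Suc n) {1..n}" "Suc n \<notin> set (u @ v)"
    "distinct (u @ v)"
    by (auto simp: permutations_of_set_def atLeastAtMostSuc_conv)
  then have "set (u @ v) = {1..n}"
    by (subst (asm) insert_ident) auto
  with uv \<open>distinct (u @ v)\<close> show "\<exists>u v. p = u @ Suc n # v \<and> u @ v \<in> permutations_of_set {1..n}"
    by (auto simp: permutations_of_set_def)
next
  assume "\<exists>u v. p = u @ Suc n # v \<and> u @ v \<in> permutations_of_set {1..n}"
  then obtain u v where uv: "p = u @ Suc n # v" "set u \<union> set v = {1..n}" "distinct (u @ v)"
    by (auto simp: permutations_of_set_def)
  have "Suc n \<notin> set u \<union> set v"
    unfolding uv(2) by simp
  then have "Suc n \<notin> set u" "Suc n \<notin> set v"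
    by simp_all
  moreover have "set p = {1..Suc n}"
    using uv by auto
  ultimately show "p \<in> permutations_of_set {1..Suc n}"
    using uv by (auto simp: permutations_of_set_def)
qed

lemma RS_Suc_iff:
  assumes "2 \<le> n"
  shows "p \<in> RS (Suc n) [1, 2, 3] \<longleftrightarrow>
    (\<exists>u v. p = u @ Suc n # v \<and> u @ v \<in> RS n [1, 2, 3] \<and>
      sorted_wrt (\<ge>) u \<and> \<not> has_double_descent (u @ Suc n # v))"
proof -
  have "simsun (u @ Suc n # v) \<and> avoids_123 (u @ Suc n # v) \<longleftrightarrow>
      simsun (u @ v) \<and> avoids_123 (u @ v) \<and>
      sorted_wrt (\<ge>) u \<and> \<not> has_double_descent (u @ Suc n # v)"
    if "u @ v \<in> permutations_of_set {1..n}" for u v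
  proof -
    from that have uv: "set (u @ v) = {1..n}" "distinct (u @ v)"
      by (auto simp: permutations_of_set_def)
    then have "\<forall>x \<in> set (u @ v). x < Suc n"
      by auto
    with uv assms show ?thesis
      using avoids_123_insert_max[of u v "Suc n"] simsun_insert_max[of u v n] by blast
  qed
  then show ?thesis
    unfolding RS_123 mem_Collect_eq permutations_of_set_Suc_iff by blast
qed

section \<open>The unique insertion place\<close>

text \<open>
  The heart of the proof.  The local shape \<open>x < y \<longleftrightarrow> y > z\<close> of the beginning of \<open>q\<close> decides
  between the first two places; a fourth entry rules out the third place.
\<close>

lemma unique_insertion_place:
  assumes "distinct q" "4 \<le> length q" "\<not> has_double_descent q" "avoids_123 q"
    and "\<forall>x \<in> set q. x < m" and "q = u @ v"
  shows "sorted_wrt (\<ge>) u \<and> \<not> has_double_descent (u @ m # v) \<longleftrightarrow>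
    u = take (if q ! 0 < q ! 1 then 0 else 1) q"
proof -
  obtain x y z w r where q: "q = x # y # z # w # r"
    using \<open>4 \<le> length q\<close> by (auto simp: Suc_le_length_iff numeral_eq_Suc)
  have ineqs: "x \<noteq> y" "y \<noteq> z" "z \<noteq> w" "x < m" "y < m" "z < m" "w < m"
      "\<not> (x > y \<and> y > z)" "\<not> (y > z \<and> z > w)" "\<not> (x < y \<and> y < z)" "\<not> (y < z \<and> z < w)"
    and dd: "\<not> has_double_descent (z # w # r)"
    using assms(1,3,4,5) by (simp_all add: q)
  consider "u = []" "v = q" | "u = [x]" "v = y # z # w # r" | "u = [x, y]" "v = z # w # r"
    | u' where "u = x # y # z # u'"
    using \<open>q = u @ v\<close> unfolding q by (auto simp: Cons_eq_append_conv)
  then show ?thesis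
  proof cases
    case 1
    then show ?thesis using ineqs dd by (simp add: q)
  next
    case 2
    then show ?thesis using ineqs dd by (simp add: q) linarith
  next
    case 3
    then show ?thesis using ineqs dd by (simp add: q) linarith
  next
    case 4
    then show ?thesis using ineqs by (simp add: q) linarith
  qed
qed

text \<open>
  The insertion of \<open>m\<close> at the place found above: in front of an initial ascent, and inside an
  initial descent.
\<close>

definition grow :: "nat \<Rightarrow> nat list \<Rightarrow> nat list" where
  "grow m q = (let k = (if q ! 0 < q ! 1 then 0 else 1) in take k q @ m # drop k q)"

lemma RS_not_double_descent:
  assumes "q \<in> RS n [1, 2, 3]" "3 \<le> n"
  shows "\<not> has_double_descent q"
proof -
  note q = RS_123D[OF assms(1)]
  from q(1) have "filter (\<lambda>x. x \<in> {1..n}) q = q"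
    by (subst filter_True) auto
  with q \<open>3 \<le> n\<close> show ?thesis
    by (metis order_refl simsun_def)
qed

lemma RS_Suc_eq_grow:
  assumes "4 \<le> n"
  shows "RS (Suc n) [1, 2, 3] = grow (Suc n) ` RS n [1, 2, 3]"
proof -
  have "2 \<le> n"
    using assms by simp
  have place: "sorted_wrt (\<ge>) u \<and> \<not> has_double_descent (u @ Suc n # v) \<longleftrightarrow>
      u = take (if (u @ v) ! 0 < (u @ v) ! 1 then 0 else 1) (u @ v)"
    if "u @ v \<in> RS n [1, 2, 3]" for u v
  proof (rule unique_insertion_place)
    show "\<not> has_double_descent (u @ v)"
      using RS_not_double_descent[OF that] assms by simp
    show "distinct (u @ v)" "avoids_123 (u @ v)" "4 \<le> length (u @ v)"
      "\<forall>x \<in> set (u @ v). x < Suc n"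
      using assms RS_123D[OF that] by auto
  qed simp
  have "p \<in> RS (Suc n) [1, 2, 3] \<longleftrightarrow> (\<exists>q \<in> RS n [1, 2, 3]. p = grow (Suc n) q)" for p
  proof
    assume "p \<in> RS (Suc n) [1, 2, 3]"
    then obtain u v where uv: "p = u @ Suc n # v" "u @ v \<in> RS n [1, 2, 3]"
      "u = take (if (u @ v) ! 0 < (u @ v) ! 1 then 0 else 1) (u @ v)"
      using RS_Suc_iff[of n p] place assms by auto
    define k :: nat where "k = (if (u @ v) ! 0 < (u @ v) ! 1 then 0 else 1)"
    have "u = take k (u @ v)"
      using uv(3) by (simp only: k_def)
    moreover from this have "v = drop k (u @ v)"
      by (metis append_take_drop_id same_append_eq)
    ultimately have "p = grow (Suc n) (u @ v)"
      unfolding grow_def k_def[symmetric] Let_def using uv(1) by metis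
    with uv(2) show "\<exists>q \<in> RS n [1, 2, 3]. p = grow (Suc n) q"
      by blast
  next
    assume "\<exists>q \<in> RS n [1, 2, 3]. p = grow (Suc n) q"
    then obtain q where q: "q \<in> RS n [1, 2, 3]" "p = grow (Suc n) q"
      by blast
    define k :: nat where "k = (if q ! 0 < q ! 1 then 0 else 1)"
    have "p = take k q @ Suc n # drop k q"
      using q(2) by (simp add: grow_def k_def Let_def)
    moreover have "sorted_wrt (\<ge>) (take k q) \<and> \<not> has_double_descent (take k q @ Suc n # drop k q)"
      using place[of "take k q" "drop k q"] q(1) by (simp add: k_def)
    ultimately show "p \<in> RS (Suc n) [1, 2, 3]"
      using RS_Suc_iff[of n p] q(1) assms by (metis append_take_drop_id \<open>2 \<le> n\<close>)
  qed
  then show ?thesis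
    by blast
qed

text \<open>Deleting the new maximum undoes the insertion.\<close>

lemma inj_on_grow: "inj_on (grow (Suc n)) (RS n [1, 2, 3])"
proof (rule inj_on_inverseI)
  fix q assume "q \<in> RS n [1, 2, 3]"
  then have "Suc n \<notin> set q"
    by (simp add: RS_123D(1))
  then have "Suc n \<notin> set (take k q)" for k
    by (meson in_set_takeD)
  then show "remove1 (Suc n) (grow (Suc n) q) = q"
    by (simp add: grow_def Let_def remove1_append)
qed

section \<open>Counting\<close>

text \<open>Rules that turn a search over the ways to split an explicit list into a finite disjunction.\<close>

lemma ex_append_eq:
  "(\<exists>u v. u @ v = [] \<and> P u v) \<longleftrightarrow> P [] []"
  "(\<exists>u v. u @ v = x # q \<and> P u v) \<longleftrightarrow> P [] (x # q) \<or> (\<exists>u v. u @ v = q \<and> P (x # u) v)"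
  by (auto simp: append_eq_Cons_conv)

lemma card_RS_4: "card (RS 4 [1, 2, 3]) = 6"
proof -
  have "simsun p" if "length p = 2" for p
    using that by (simp add: simsun_def)
  moreover have "{1..2} = {1, 2::nat}"
    by auto
  ultimately have RS2: "RS 2 [1, 2, 3] = {[1, 2], [2, 1]}"
    unfolding RS_123 by (auto simp: permutations_of_set_doubleton)
  \<comment> \<open>Naming the shorter permutation \<open>q\<close> first lets an explicit list be substituted for \<open>u @ v\<close>.\<close>
  have step: "p \<in> RS (Suc n) [1, 2, 3] \<longleftrightarrow> (\<exists>q \<in> RS n [1, 2, 3]. \<exists>u v. u @ v = q \<and>
      (p = u @ Suc n # v \<and> sorted_wrt (\<ge>) u \<and> \<not> has_double_descent (u @ Suc n # v)))"
    if "2 \<le> n" for n p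
    using RS_Suc_iff[OF that, of p] by blast
  have "p \<in> RS (Suc 2) [1, 2, 3] \<longleftrightarrow> p \<in> {[2, 1, 3], [2, 3, 1], [3, 1, 2], [1, 3, 2]}" for p
    unfolding step[OF order_refl] RS2 by (auto simp: ex_append_eq)
  then have RS3: "RS (Suc 2) [1, 2, 3] = {[2, 1, 3], [2, 3, 1], [3, 1, 2], [1, 3, 2]}"
    by blast
  have "2 \<le> Suc 2"
    by simp
  have "p \<in> RS (Suc (Suc 2)) [1, 2, 3] \<longleftrightarrow> p \<in> {[2, 1, 4, 3], [2, 4, 1, 3], [3, 1, 4, 2],
      [3, 4, 1, 2], [4, 1, 3, 2], [4, 2, 3, 1]}" for p
    unfolding step[OF \<open>2 \<le> Suc 2\<close>] RS3 by (auto simp: ex_append_eq)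
  then have "RS (Suc (Suc 2)) [1, 2, 3] = {[2, 1, 4, 3], [2, 4, 1, 3], [3, 1, 4, 2],
      [3, 4, 1, 2], [4, 1, 3, 2], [4, 2, 3, 1]}"
    by blast
  moreover have "Suc (Suc 2) = 4"
    by simp
  ultimately show ?thesis
    by simp
qed

theorem proposition2p1:
  fixes n :: nat
  assumes "n \<ge> 4"
  shows "card (RS n [1, 2, 3]) = 6"
  using assms
proof (induction n rule: dec_induct)
  case base
  show ?case by (rule card_RS_4)
next
  case (step n)
  show ?case
    unfolding RS_Suc_eq_grow[OF step.hyps(1)] card_image[OF inj_on_grow] by (rule step.IH)
qed

end
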